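(* Let $N=\{1,\ldots,n\}$ and let $C \subset \mathbb{R}^n$ be a compact convex set. The following statements are equivalent: (1) $C$ has a least $(a,b)$-majorized element for each $a \in \mathbb{R}^n_{>0}$ and $b \in \mathbb{R}^n$; (2) $C$ has a least $(1,b)$-majorized element for each $b \in \mathbb{R}^n$; (3) for each $b \in \mathbb{R}^n$, there exists $x^* \in C$ that is an optimal solution to $\min_{x \in C} \Phi(x+b)$ for any choice of continuous Schur-convex function $\Phi:\mathbb{R}^n\to\mathbb{R}$; (4) the function $f(A) := \max_{x \in C} x(A)$, $A\subseteq N$, is submodular and $C = B(f)$.
   Context: Notation: $x(A) := \sum_{i\in A} x_i$ for $x\in\mathbb{R}^n$, $A\subseteq N$; in "$(1,b)$", $1$ is the all-ones vector. $(a,b)$-majorization: for $a\in\mathbb{R}^n_{>0}$, $b\in\mathbb{R}^n$, $x$ is $(a,b)$-majorized by $y$ if $x(N)=y(N)$ and $\sum_{i\in N} a_i\phi\left(\frac{x_i+b_i}{a_i}\right)\le \sum_{i\in N} a_i\phi\left(\frac{y_i+b_i}{a_i}\right)$ for all continuous convex functions $\phi:\mathbb{R}\to\mathbb{R}$. A vector $x\in C$ is a least $(a,b)$-majorized element of $C$ if $x$ is $(a,b)$-majorized by every $y\in C$. Schur-convexity: let $x^{\downarrow}$ denote the rearrangement of $x$ in non-increasing order; $x\prec y$ if $\sum_{i=1}^k x^{\downarrow}_i\le\sum_{i=1}^k y^{\downarrow}_i$ for all $k\in N$ and $x(N)=y(N)$. $\Phi:\mathbb{R}^n\to\mathbb{R}$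 is Schur-convex if $x\prec y$ implies $\Phi(x)\le\Phi(y)$. Submodularity: $f:2^N\to\mathbb{R}$ with $f(\emptyset)=0$ is submodular if $f(A)+f(B)\ge f(A\cup B)+f(A\cap B)$ for all $A,B\subseteq N$. The base polyhedron is $B(f):=\{x\in\mathbb{R}^n: x(A)\le f(A)\ \forall A\subseteq N,\ x(N)=f(N)\}$. *)

theory Defs
  imports "HOL-Analysis.Analysis" "HOL-Library.Multiset"
begin

text \<open>The ground set \<open>N = {1, ..., n}\<close> is the universe of a finite type
  \<open>'n\<close> with \<open>n = CARD('n)\<close>; subsets of \<open>N\<close> are terms of type \<open>'n set\<close>.\<close>

definition coord_sum :: "real ^ 'n \<Rightarrow> 'n::finite set \<Rightarrow> real" where
  "coord_sum x A = (\<Sum>i\<in>A. x $ i)"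

text \<open>\<open>ab_majorized a b x y\<close>: the vector \<open>x\<close> is \<open>(a,b)\<close>-majorized by \<open>y\<close>. This is meant
  for \<open>a\<close> with positive components only.\<close>

definition ab_majorized ::
    "real ^ 'n \<Rightarrow> real ^ 'n \<Rightarrow> real ^ 'n \<Rightarrow> real ^ 'n::finite \<Rightarrow> bool" where
  "ab_majorized a b x y \<longleftrightarrow>
     coord_sum x UNIV = coord_sum y UNIV \<and>
     (\<forall>\<phi> :: real \<Rightarrow> real. continuous_on UNIV \<phi> \<and> convex_on UNIV \<phi> \<longrightarrow>
        (\<Sum>i\<in>UNIV. a $ i * \<phi> ((x $ i + b $ i) / a $ i))
          \<le> (\<Sum>i\<in>UNIV. a $ i * \<phi> ((y $ i + b $ i) / a $ i)))"

definition least_ab_majorized ::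
    "real ^ 'n \<Rightarrow> real ^ 'n \<Rightarrow> (real ^ 'n::finite) set \<Rightarrow> real ^ 'n \<Rightarrow> bool" where
  "least_ab_majorized a b C x \<longleftrightarrow> x \<in> C \<and> (\<forall>y\<in>C. ab_majorized a b x y)"

text \<open>Since the index type carries no order, the non-increasing rearrangement of a vector
  is given as a list of length \<open>CARD('n)\<close>.\<close>

definition decr_rearrangement :: "real ^ 'n::finite \<Rightarrow> real list" where
  "decr_rearrangement x =
     rev (sorted_list_of_multiset (image_mset (\<lambda>i. x $ i) (mset_set UNIV)))"

definition majorized :: "real ^ 'n::finite \<Rightarrow> real ^ 'n \<Rightarrow> bool" where
  "majorized x y \<longleftrightarrow>
     (\<forall>k\<in>{1..CARD('n)}.
        sum_list (take k (decr_rearrangement x)) \<le> sum_list (take k (decr_rearrangement y))) \<and>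
     coord_sum x UNIV = coord_sum y UNIV"

definition schur_convex :: "(real ^ 'n::finite \<Rightarrow> real) \<Rightarrow> bool" where
  "schur_convex \<Phi> \<longleftrightarrow> (\<forall>x y. majorized x y \<longrightarrow> \<Phi> x \<le> \<Phi> y)"

definition submodular :: "('n::finite set \<Rightarrow> real) \<Rightarrow> bool" where
  "submodular f \<longleftrightarrow> f {} = 0 \<and> (\<forall>A B. f A + f B \<ge> f (A \<union> B) + f (A \<inter> B))"

definition base_polyhedron :: "('n::finite set \<Rightarrow> real) \<Rightarrow> (real ^ 'n) set" where
  "base_polyhedron f =
     {x. (\<forall>A. coord_sum x A \<le> f A) \<and> coord_sum x UNIV = f UNIV}"

text \<open>For nonempty compact \<open>C\<close> the supremum below is a maximum. For empty \<open>C\<close> it is the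
  unspecified real \<open>Sup {}\<close>, independently of \<open>A\<close>; if this constant function is submodular
  then it is zero and its base polyhedron is \<open>{0} \<noteq> C\<close>.\<close>

definition max_coord_sum :: "(real ^ 'n::finite) set \<Rightarrow> 'n set \<Rightarrow> real" where
  "max_coord_sum C A = (SUP x\<in>C. coord_sum x A)"

end

theory Submission imports Defs begin

text \<open>Sums of the
  \<open>k\<close> largest entries are compared through \<open>k * t + (\<Sum>i. max 0 (z\<^sub>i - t))\<close>, which bounds them from above
  for every \<open>t\<close> and equals them when \<open>t\<close> is the \<open>k\<close>-th largest entry; this gives \<open>(2) \<Longrightarrow> (3)\<close> and the Schur
  convexity of \<open>\<lambda>z. \<Sum>i. max 0 (t - z\<^sub>i)\<close>. For \<open>(3) \<Longrightarrow> (4)\<close>, take \<open>b = - K w\<close> with \<open>K\<close> so large that the level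
  sets of \<open>w\<close> are separated uniformly over \<open>C\<close>: minimizing these functions yields one point of \<open>C\<close> that
  maximizes the coordinate sum over all upper level sets of \<open>w\<close>. Applied to the two-step chain
  \<open>A \<inter> B \<subseteq> A \<union> B\<close> this is submodularity, and applied to the normal of a separating hyperplane it is
  \<open>C = B(f)\<close>. For \<open>(4) \<Longrightarrow> (1)\<close>, minimize \<open>\<Sum>i. (x\<^sub>i + b\<^sub>i)\<^sup>2 / a\<^sub>i\<close> over \<open>B(f)\<close>: by an exchange argument the
  minimizer is tight on all lower level sets of \<open>(x\<^sub>i + b\<^sub>i) / a\<^sub>i\<close>, and summation by parts against
  subgradients of \<open>\<phi>\<close> concludes.\<close>

subsection \<open>Summation by parts over level sets\<close>

text \<open>Abel summation: a nonnegative \<open>w\<close> is a nonnegative combination of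
  indicators of its upper level sets. The induction peels off the lowest layer, the least positive
  value \<open>m\<close> times the indicator of the support; level \<open>t\<close> of the rest is
  level \<open>t + m\<close> of \<open>w\<close>.\<close>

lemma sum_mult_nonneg_of_upper_level_nonneg:
  fixes w d :: "'a::finite \<Rightarrow> real"
  assumes "\<And>i. w i \<ge> 0" and "\<And>t. t > 0 \<Longrightarrow> (\<Sum>i\<in>{i. t \<le> w i}. d i) \<ge> 0"
  shows "(\<Sum>i\<in>UNIV. w i * d i) \<ge> 0"
  using assms
proof (induction "card {i. w i > 0}" arbitrary: w rule: less_induct)
  case less
  show ?case
  proof (cases "{i. w i > 0} = {}")
    case True
    then have "w i = 0" for i using less.prems(1)[of i] by (auto simp: order_less_le)
    then show ?thesis by simp
  next
    case False
    let ?S = "{i. w i > 0}"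
    define m where "m = Min (w ` ?S)"
    have "m \<in> w ` ?S" unfolding m_def using False by (intro Min_in) auto
    then obtain k where k: "w k > 0" "m = w k" by auto
    have m_le: "m \<le> w i" if "w i > 0" for i unfolding m_def using that by (intro Min_le) auto
    define w' where "w' i = (if w i > 0 then w i - m else 0)" for i
    have "{i. w' i > 0} \<subset> ?S" using k by (auto simp: w'_def split: if_splits)
    then have card: "card {i. w' i > 0} < card ?S" by (intro psubset_card_mono) auto
    have "0 \<le> (\<Sum>i\<in>UNIV. w' i * d i)"
    proof (rule less.hyps[OF card])
      show "w' i \<ge> 0" for i using m_le by (auto simp: w'_def)
      show "(\<Sum>i\<in>{i. t \<le> w' i}. d i) \<ge> 0" if "t > 0" for t
      proof -
        have "{i. t \<le> w' i} = {i. t + m \<le> w i}"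
          using that k by (auto simp: w'_def split: if_splits)
        then show ?thesis using less.prems(2)[of "t + m"] that k by simp
      qed
    qed
    moreover have "0 \<le> m * (\<Sum>i\<in>?S. d i)"
    proof -
      have "?S = {i. m \<le> w i}" using m_le k by auto
      then show ?thesis using less.prems(2)[of m] k by simp
    qed
    moreover have "(\<Sum>i\<in>UNIV. w i * d i) = (\<Sum>i\<in>UNIV. w' i * d i) + m * (\<Sum>i\<in>?S. d i)"
    proof -
      have "w i * d i = w' i * d i + (if i \<in> ?S then m * d i else 0)" for i
        using less.prems(1)[of i] by (auto simp: w'_def algebra_simps)
      then show ?thesis
        by (simp add: sum.distrib sum_distrib_left sum.If_cases)
    qed
    ultimately show ?thesis by linarith
  qed
qed

text \<open>Because \<open>d\<close> has total zero, subtracting the minimum from \<open>w\<close>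
  leaves the sum unchanged, so signed weights reduce to nonnegative ones.\<close>

lemma sum_mult_nonneg_of_level_sums:
  fixes w d :: "'a::finite \<Rightarrow> real"
  assumes total: "(\<Sum>i\<in>UNIV. d i) = 0" and upper: "\<And>t. (\<Sum>i\<in>{i. t \<le> w i}. d i) \<ge> 0"
  shows "(\<Sum>i\<in>UNIV. w i * d i) \<ge> 0"
proof -
  define m where "m = Min (range w)"
  have m_le: "m \<le> w i" for i unfolding m_def by (intro Min_le) auto
  have "0 \<le> (\<Sum>i\<in>UNIV. (w i - m) * d i)"
  proof (rule sum_mult_nonneg_of_upper_level_nonneg)
    show "(\<Sum>i\<in>{i. t \<le> w i - m}. d i) \<ge> 0" for t
      using upper[of "t + m"] by (simp add: algebra_simps)
  qed (simp add: m_le)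
  also have "\<dots> = (\<Sum>i\<in>UNIV. w i * d i) - m * (\<Sum>i\<in>UNIV. d i)"
    by (simp add: left_diff_distrib sum_subtractf sum_distrib_left)
  finally show ?thesis using total by simp
qed

subsection \<open>Sums of the largest entries\<close>

lemma mset_decr_rearrangement:
  "mset (decr_rearrangement x) = image_mset (\<lambda>i. x $ i) (mset_set UNIV)"
  by (simp add: decr_rearrangement_def)

lemma length_decr_rearrangement [simp]:
  fixes x :: "real ^ 'n::finite"
  shows "length (decr_rearrangement x) = CARD('n)"
  by (metis mset_decr_rearrangement size_mset size_image_mset size_mset_set)

lemma sorted_decr_rearrangement: "sorted_wrt (\<ge>) (decr_rearrangement x)"
  by (simp add: decr_rearrangement_def sorted_wrt_rev)

lemma sum_list_map_decr_rearrangement: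
  fixes g :: "real \<Rightarrow> real"
  shows "sum_list (map g (decr_rearrangement x)) = (\<Sum>i\<in>UNIV. g (x $ i))"
proof -
  have "sum_list (map g (decr_rearrangement x)) = sum_mset (image_mset g (mset (decr_rearrangement x)))"
    by (metis mset_map sum_mset_sum_list)
  also have "\<dots> = (\<Sum>i\<in>UNIV. g (x $ i))"
    by (simp add: mset_decr_rearrangement sum_unfold_sum_mset multiset.map_comp comp_def)
  finally show ?thesis .
qed

text \<open>Each taken entry \<open>u\<close> is at most \<open>t + max 0 (u - t)\<close>, and the
  dropped entries only add nonnegative terms.\<close>

lemma sum_list_take_le_excess:
  fixes xs :: "real list"
  assumes "k \<le> length xs"
  shows "sum_list (take k xs) \<le> k * t + sum_list (map (\<lambda>u. max 0 (u - t)) xs)"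
proof -
  have "sum_list ys \<le> length ys * t + sum_list (map (\<lambda>u. max 0 (u - t)) ys)" for ys :: "real list"
    by (induction ys) (auto simp: algebra_simps max_def)
  from this[of "take k xs"] assms
  have "sum_list (take k xs) \<le> k * t + sum_list (map (\<lambda>u. max 0 (u - t)) (take k xs))"
    by (simp add: min_absorb2)
  moreover have "0 \<le> sum_list (map (\<lambda>u. max 0 (u - t)) (drop k xs))"
    by (intro sum_list_nonneg) auto
  moreover have "sum_list (map (\<lambda>u. max 0 (u - t)) xs) =
      sum_list (map (\<lambda>u. max 0 (u - t)) (take k xs)) + sum_list (map (\<lambda>u. max 0 (u - t)) (drop k xs))"
    by (metis append_take_drop_id map_append sum_list_append)
  ultimately show ?thesis by linarith
qed

text \<open>Both losses in \<open>sum_list_take_le_excess\<close> vanish when \<open>t\<close>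
  separates the taken entries from the dropped ones.\<close>

lemma sum_list_take_eq_excess:
  fixes xs :: "real list"
  assumes "k \<le> length xs" "\<forall>u\<in>set (take k xs). t \<le> u" "\<forall>u\<in>set (drop k xs). u \<le> t"
  shows "sum_list (take k xs) = k * t + sum_list (map (\<lambda>u. max 0 (u - t)) xs)"
proof -
  have "\<forall>u\<in>set ys. t \<le> u \<Longrightarrow> sum_list ys = length ys * t + sum_list (map (\<lambda>u. max 0 (u - t)) ys)"
    for ys :: "real list"
    by (induction ys) (auto simp: algebra_simps max_def)
  from this[of "take k xs"] assms(1,2)
  have "sum_list (take k xs) = k * t + sum_list (map (\<lambda>u. max 0 (u - t)) (take k xs))"
    by (simp add: min_absorb2)
  moreover have "sum_list (map (\<lambda>u. max 0 (u - t)) (drop k xs)) = 0"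
    using assms(3) by (subst sum_list_nonneg_eq_0_iff) auto
  moreover have "sum_list (map (\<lambda>u. max 0 (u - t)) xs) =
      sum_list (map (\<lambda>u. max 0 (u - t)) (take k xs)) + sum_list (map (\<lambda>u. max 0 (u - t)) (drop k xs))"
    by (metis append_take_drop_id map_append sum_list_append)
  ultimately show ?thesis by simp
qed

lemma majorizedI_excess:
  fixes x y :: "real ^ 'n::finite"
  assumes total: "coord_sum x UNIV = coord_sum y UNIV"
    and excess: "\<And>t. (\<Sum>i\<in>UNIV. max 0 (x $ i - t)) \<le> (\<Sum>i\<in>UNIV. max 0 (y $ i - t))"
  shows "majorized x y"
  unfolding majorized_def
proof (intro conjI ballI total)
  fix k assume k: "k \<in> {1..CARD('n)}"
  let ?xs = "decr_rearrangement x" and ?ys = "decr_rearrangement y"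
  \<comment> \<open>The \<open>k\<close>-th largest entry of \<open>y\<close>, with lists indexed
    from 0: the excess bound is exact for \<open>y\<close> and still an upper bound for
    \<open>x\<close>.\<close>
  define t where "t = ?ys ! (k - 1)"
  have sorted: "i \<le> j \<Longrightarrow> j < CARD('n) \<Longrightarrow> ?ys ! j \<le> ?ys ! i" for i j
    using sorted_wrt_nth_less[OF sorted_decr_rearrangement[of y], of i j]
    by (cases "i = j") auto
  have "sum_list (take k ?xs) \<le> k * t + (\<Sum>i\<in>UNIV. max 0 (x $ i - t))"
    using sum_list_take_le_excess[of k ?xs t] k
    by (simp add: sum_list_map_decr_rearrangement)
  also have "\<dots> \<le> k * t + (\<Sum>i\<in>UNIV. max 0 (y $ i - t))"
    using excess by simp
  also have "\<dots> = sum_list (take k ?ys)"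
  proof -
    have "\<forall>u\<in>set (take k ?ys). t \<le> u"
      using k sorted by (auto simp: in_set_conv_nth t_def)
    moreover have "\<forall>u\<in>set (drop k ?ys). u \<le> t"
      using k sorted by (auto simp: in_set_conv_nth t_def)
    ultimately show ?thesis
      using sum_list_take_eq_excess[of k ?ys t] k
      by (simp add: sum_list_map_decr_rearrangement)
  qed
  finally show "sum_list (take k ?xs) \<le> sum_list (take k ?ys)" .
qed

text \<open>Here \<open>t\<close> is given and \<open>k\<close> adapts to it: with \<open>k\<close>
  the number of entries of \<open>x\<close> above \<open>t\<close>, the bound is exact for
  \<open>x\<close> and an upper bound for \<open>y\<close>.\<close>

lemma majorized_excess_le:
  fixes x y :: "real ^ 'n::finite"
  assumes "majorized x y"
  shows "(\<Sum>i\<in>UNIV. max 0 (x $ i - t)) \<le> (\<Sum>i\<in>UNIV. max 0 (y $ i - t))"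
proof -
  let ?xs = "decr_rearrangement x" and ?ys = "decr_rearrangement y"
  define k where "k = length (takeWhile (\<lambda>u. t < u) ?xs)"
  have k: "k \<le> CARD('n)"
    unfolding k_def using length_takeWhile_le[of "\<lambda>u. t < u" ?xs] by simp
  have take: "take k ?xs = takeWhile (\<lambda>u. t < u) ?xs"
    by (simp add: k_def takeWhile_eq_take[symmetric])
  have "drop k ?xs = dropWhile (\<lambda>u. t < u) ?xs"
    by (simp add: k_def dropWhile_eq_drop[symmetric])
  then have drop_le: "u \<le> t" if u: "u \<in> set (drop k ?xs)" for u
  proof -
    obtain v vs where vs: "drop k ?xs = v # vs" using u by (metis list.exhaust empty_iff list.set(1))
    have "\<not> t < v"
      using \<open>drop k ?xs = dropWhile _ _\<close> vs
      by (metis hd_dropWhile list.distinct(1) list.sel(1))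
    moreover have "sorted_wrt (\<ge>) (drop k ?xs)"
      by (intro sorted_wrt_drop sorted_decr_rearrangement)
    ultimately show ?thesis using u vs by force
  qed
  have "k * t + (\<Sum>i\<in>UNIV. max 0 (x $ i - t)) = sum_list (take k ?xs)"
  proof -
    have "\<forall>u\<in>set (take k ?xs). t \<le> u" unfolding take by (auto dest: set_takeWhileD)
    then show ?thesis
      using sum_list_take_eq_excess[of k ?xs t, unfolded sum_list_map_decr_rearrangement] k drop_le
      by simp
  qed
  also have "\<dots> \<le> sum_list (take k ?ys)"
    \<comment> \<open>\<open>majorized\<close> speaks only of \<open>k\<close> from 1 on; for
      \<open>k = 0\<close> both sums are empty.\<close>
    using assms k by (cases "k = 0") (auto simp: majorized_def)
  also have "\<dots> \<le> k * t + (\<Sum>i\<in>UNIV. max 0 (y $ i - t))"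
    using sum_list_take_le_excess[of k ?ys t] k
    by (simp add: sum_list_map_decr_rearrangement)
  finally show ?thesis by simp
qed

text \<open>Deficit and excess differ by \<open>n * t\<close> minus the total, and majorization
  preserves the total.\<close>

lemma schur_convex_sum_deficit:
  "schur_convex (\<lambda>z :: real ^ 'n::finite. \<Sum>i\<in>UNIV. max 0 (t - z $ i))"
  unfolding schur_convex_def
proof (intro allI impI)
  fix x y :: "real ^ 'n" assume "majorized x y"
  have "(\<Sum>i\<in>UNIV. max 0 (t - z $ i)) = (\<Sum>i\<in>UNIV. max 0 (z $ i - t)) + CARD('n) * t - coord_sum z UNIV"
    for z :: "real ^ 'n"
  proof -
    have "max 0 (t - z $ i) = max 0 (z $ i - t) + t - z $ i" for i by simp
    then show ?thesis by (simp only: sum.distrib sum_subtractf coord_sum_def) simp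
  qed
  moreover have "coord_sum x UNIV = coord_sum y UNIV"
    using \<open>majorized x y\<close> by (simp add: majorized_def)
  ultimately show "(\<Sum>i\<in>UNIV. max 0 (t - x $ i)) \<le> (\<Sum>i\<in>UNIV. max 0 (t - y $ i))"
    using majorized_excess_le[OF \<open>majorized x y\<close>, of t] by simp
qed

lemma convex_on_excess: "convex_on UNIV (\<lambda>s::real. max 0 (s - t))"
proof (rule convex_onI)
  fix r x y :: real assume r: "0 < r" "r < 1"
  have "(1 - r) * (x - t) + r * (y - t) \<le> (1 - r) * max 0 (x - t) + r * max 0 (y - t)"
    using r by (intro add_mono mult_left_mono) auto
  moreover have "0 \<le> (1 - r) * max 0 (x - t) + r * max 0 (y - t)" using r by simp
  moreover have "(1 - r) *\<^sub>R x + r *\<^sub>R y - t = (1 - r) * (x - t) + r * (y - t)"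
    by (simp add: algebra_simps)
  ultimately show "max 0 ((1 - r) *\<^sub>R x + r *\<^sub>R y - t) \<le> (1 - r) * max 0 (x - t) + r * max 0 (y - t)"
    by simp
qed simp

text \<open>With unit weights, the hinge functions \<open>max 0 (s - t)\<close> are enough test
  functions to recover majorization.\<close>

lemma majorized_of_ab_majorized:
  fixes x y b :: "real ^ 'n::finite"
  assumes "ab_majorized (\<chi> i. 1) b x y"
  shows "majorized (x + b) (y + b)"
proof (rule majorizedI_excess)
  show "coord_sum (x + b) UNIV = coord_sum (y + b) UNIV"
    using assms by (simp add: ab_majorized_def coord_sum_def sum.distrib)
  fix t
  have "continuous_on UNIV (\<lambda>s::real. max 0 (s - t))" by (intro continuous_intros)
  with assms convex_on_excess[of t]
  show "(\<Sum>i\<in>UNIV. max 0 ((x + b) $ i - t)) \<le> (\<Sum>i\<in>UNIV. max 0 ((y + b) $ i - t))"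
    unfolding ab_majorized_def by (auto dest: spec[of _ "\<lambda>s. max 0 (s - t)"])
qed

subsection \<open>From simultaneous minimizers to base polyhedra\<close>

lemma abs_coord_sum_le: "\<bar>coord_sum x A\<bar> \<le> CARD('n) * norm x" for x :: "real ^ 'n::finite"
proof -
  have "\<bar>coord_sum x A\<bar> \<le> (\<Sum>i\<in>A. norm x)"
    unfolding coord_sum_def by (rule order_trans[OF sum_abs sum_mono]) (rule component_le_norm_cart)
  also have "\<dots> \<le> CARD('n) * norm x" by (auto intro!: mult_right_mono card_mono)
  finally show ?thesis .
qed

lemma bdd_above_coord_sum:
  fixes C :: "(real ^ 'n::finite) set"
  assumes "bounded C"
  shows "bdd_above ((\<lambda>x. coord_sum x A) ` C)"
proof -
  obtain R where R: "\<forall>x\<in>C. norm x \<le> R" using assms by (auto simp: bounded_iff)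
  show ?thesis
  proof (rule bdd_aboveI2)
    fix x assume "x \<in> C"
    have "coord_sum x A \<le> CARD('n) * norm x" using abs_coord_sum_le[of x A] by linarith
    also have "\<dots> \<le> CARD('n) * R" using R \<open>x \<in> C\<close> by (intro mult_left_mono) auto
    finally show "coord_sum x A \<le> CARD('n) * R" .
  qed
qed

lemma coord_sum_le_max_coord_sum:
  "bounded C \<Longrightarrow> x \<in> C \<Longrightarrow> coord_sum x A \<le> max_coord_sum C A"
  unfolding max_coord_sum_def by (rule cSUP_upper[OF _ bdd_above_coord_sum])

lemma max_coord_sum_eqI:
  "x \<in> C \<Longrightarrow> (\<And>y. y \<in> C \<Longrightarrow> coord_sum y A \<le> coord_sum x A) \<Longrightarrow> max_coord_sum C A = coord_sum x A"
  unfolding max_coord_sum_def by (rule cSup_eq_maximum) auto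

lemma separating_scale:
  fixes w :: "'a::finite \<Rightarrow> real"
  obtains K where "K \<ge> 0" "\<And>i j. w i < w j \<Longrightarrow> K * w i + R \<le> K * w j"
proof -
  define P where "P = {(i, j). w i < w j}"
  \<comment> \<open>There are finitely many gaps, and a sum of nonnegative terms dominates each of
    them, so one \<open>K\<close> stretches every gap to at least \<open>R\<close>.\<close>
  define K where "K = (\<Sum>(i, j)\<in>P. \<bar>R\<bar> / (w j - w i))"
  have "K * w i + R \<le> K * w j" if "w i < w j" for i j
  proof -
    have "(case (i, j) of (i, j) \<Rightarrow> \<bar>R\<bar> / (w j - w i)) \<le> K"
      unfolding K_def using that by (intro member_le_sum) (auto simp: P_def)
    then have "\<bar>R\<bar> \<le> K * (w j - w i)" using that by (simp add: pos_divide_le_eq)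
    then have "R \<le> K * w j - K * w i" by (simp add: right_diff_distrib)
    then show ?thesis by simp
  qed
  moreover have "K \<ge> 0" unfolding K_def P_def by (intro sum_nonneg) auto
  ultimately show ?thesis by (rule that[rotated])
qed

text \<open>For a suitable \<open>t\<close>, the deficit of \<open>y + b\<close> is a constant minus
  the coordinate sum of \<open>y\<close> over a level set. Since \<open>x\<close> is chosen before
  \<open>t\<close>, it handles all level sets at once.\<close>

lemma coord_sum_upper_level_maximizer:
  fixes C :: "(real ^ 'n::finite) set" and w :: "'n \<Rightarrow> real"
  assumes "bounded C"
    and minimizer: "\<And>b. \<exists>x\<in>C. \<forall>t. \<forall>y\<in>C.
      (\<Sum>i\<in>UNIV. max 0 (t - (x + b) $ i)) \<le> (\<Sum>i\<in>UNIV. max 0 (t - (y + b) $ i))"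
  obtains x where "x \<in> C"
    "\<And>c y. y \<in> C \<Longrightarrow> coord_sum y {i. c \<le> w i} \<le> coord_sum x {i. c \<le> w i}"
proof -
  obtain R where R: "\<And>y. y \<in> C \<Longrightarrow> norm y \<le> R" using assms(1) by (auto simp: bounded_iff)
  have comp: "\<bar>y $ i\<bar> \<le> R" if "y \<in> C" for y i
    using R[OF that] component_le_norm_cart[of y i] by linarith
  \<comment> \<open>Coordinates of points of \<open>C\<close> lie in an interval of length
    \<open>2 * R\<close>, so gaps of this size cannot be bridged inside \<open>C\<close>.\<close>
  obtain K where "K \<ge> 0" and K: "\<And>i j. w i < w j \<Longrightarrow> K * w i + 2 * R \<le> K * w j"
    using separating_scale[of w "2 * R"] by metis
  define b :: "real ^ 'n" where "b = (\<chi> i. - K * w i)"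
  obtain x where x: "x \<in> C" and min: "\<And>t y. y \<in> C \<Longrightarrow>
      (\<Sum>i\<in>UNIV. max 0 (t - (x + b) $ i)) \<le> (\<Sum>i\<in>UNIV. max 0 (t - (y + b) $ i))"
    using minimizer[of b] by blast
  have "coord_sum y {i. c \<le> w i} \<le> coord_sum x {i. c \<le> w i}" if y: "y \<in> C" for c y
  proof (cases "{i. c \<le> w i} = {}")
    case True
    then show ?thesis by (simp only: coord_sum_def sum.empty order_refl)
  next
    case False
    let ?L = "{i. c \<le> w i}"
    \<comment> \<open>The level \<open>c\<close> may fall between values of \<open>w\<close>; the
      cut must be placed at an attained one.\<close>
    have "Min (w ` ?L) \<in> w ` ?L" using False by (intro Min_in) auto
    then obtain l where l: "c \<le> w l" "Min (w ` ?L) = w l" by auto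
    have l_le: "w l \<le> w i" if "c \<le> w i" for i
      using that l(2)[symmetric] by (auto intro: Min_le)
    \<comment> \<open>All shifted coordinates in \<open>?L\<close> are at most \<open>t\<close> and
      all others at least \<open>t\<close>, so exactly the terms from \<open>?L\<close> survive in
      the deficit.\<close>
    define t where "t = R - K * w l"
    have deficit: "(\<Sum>i\<in>UNIV. max 0 (t - (z + b) $ i)) = (\<Sum>i\<in>?L. t - b $ i) - coord_sum z ?L"
      if z: "z \<in> C" for z
    proof -
      have "max 0 (t - (z + b) $ i) = (if i \<in> ?L then t - b $ i - z $ i else 0)" for i
      proof (cases "i \<in> ?L")
        case True
        then have "K * w l \<le> K * w i" using l_le \<open>K \<ge> 0\<close> by (intro mult_left_mono) auto
        then show ?thesis using True comp[OF z, of i] by (auto simp: t_def b_def)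
      next
        case False
        then have "w i < w l" using l by simp
        then show ?thesis using K[of i l] False comp[OF z, of i] by (auto simp: t_def b_def)
      qed
      then show ?thesis by (simp add: sum.If_cases coord_sum_def sum_subtractf)
    qed
    show ?thesis using min[OF y, of t] unfolding deficit[OF x] deficit[OF y] by simp
  qed
  with x show ?thesis by (rule that)
qed

lemma submodular_base_polyhedron_of_upper_level_maximizers:
  fixes C :: "(real ^ 'n::finite) set"
  assumes "compact C" "convex C" "C \<noteq> {}"
    and total: "\<And>x y. x \<in> C \<Longrightarrow> y \<in> C \<Longrightarrow> coord_sum x UNIV = coord_sum y UNIV"
    and maximizer: "\<And>w :: 'n \<Rightarrow> real. \<exists>x\<in>C. \<forall>c. \<forall>y\<in>C. coord_sum y {i. c \<le> w i} \<le> coord_sum x {i. c \<le> w i}"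
  shows "submodular (max_coord_sum C)" "C = base_polyhedron (max_coord_sum C)"
proof -
  let ?f = "max_coord_sum C"
  have bounded: "bounded C" using \<open>compact C\<close> by (rule compact_imp_bounded)
  have le: "coord_sum x A \<le> ?f A" if "x \<in> C" for x A
    by (rule coord_sum_le_max_coord_sum[OF bounded that])
  have total_eq: "coord_sum x UNIV = ?f UNIV" if "x \<in> C" for x
    using max_coord_sum_eqI[OF that, of UNIV] total[OF _ that] by simp
  have maximizer_f: "\<exists>x\<in>C. \<forall>c. coord_sum x {i. c \<le> w i} = ?f {i. c \<le> w i}"
    for w :: "'n \<Rightarrow> real"
    using maximizer[of w] max_coord_sum_eqI by metis
  show "submodular ?f"
    unfolding submodular_def
  proof (intro conjI allI)
    obtain x where "x \<in> C" using \<open>C \<noteq> {}\<close> by blast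
    then show "?f {} = 0" using max_coord_sum_eqI[of x C "{}"] by (simp add: coord_sum_def)
    fix A B
    \<comment> \<open>The levels 1 and 2 of this sum of indicators are the union and the
      intersection, so a single \<open>x\<close> attains \<open>?f\<close> on both.\<close>
    define w :: "'n \<Rightarrow> real" where "w i = (if i \<in> A then 1 else 0) + (if i \<in> B then 1 else 0)" for i
    obtain x where x: "x \<in> C" "\<And>c. coord_sum x {i. c \<le> w i} = ?f {i. c \<le> w i}"
      using maximizer_f[of w] by blast
    have "{i. 2 \<le> w i} = A \<inter> B" "{i. 1 \<le> w i} = A \<union> B"
      by (auto simp: w_def split: if_splits)
    then have "?f (A \<union> B) + ?f (A \<inter> B) = coord_sum x (A \<union> B) + coord_sum x (A \<inter> B)"
      using x(2)[of 1] x(2)[of 2] by simp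
    also have "\<dots> = coord_sum x A + coord_sum x B"
      unfolding coord_sum_def by (rule sum.union_inter) auto
    also have "\<dots> \<le> ?f A + ?f B" using le[OF x(1)] by (intro add_mono)
    finally show "?f (A \<union> B) + ?f (A \<inter> B) \<le> ?f A + ?f B" .
  qed
  show "C = base_polyhedron ?f"
  proof
    show "C \<subseteq> base_polyhedron ?f" using le total_eq by (auto simp: base_polyhedron_def)
    show "base_polyhedron ?f \<subseteq> C"
    proof (rule subsetI, rule ccontr)
      fix z assume z: "z \<in> base_polyhedron ?f" and "z \<notin> C"
      obtain v c where v: "inner v z < c" "\<forall>y\<in>C. inner v y > c"
        using separating_hyperplane_closed_point[OF \<open>convex C\<close> compact_imp_closed[OF \<open>compact C\<close>] \<open>z \<notin> C\<close>]
        by blast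
      \<comment> \<open>The sign turns separation into \<open>w\<close> being larger at
        \<open>z\<close> than on all of \<open>C\<close>, whereas tightness of \<open>x\<close> on
        the upper level sets of \<open>w\<close> gives the opposite inequality.\<close>
      define w where "w i = - v $ i" for i
      obtain x where x: "x \<in> C" "\<And>c. coord_sum x {i. c \<le> w i} = ?f {i. c \<le> w i}"
        using maximizer_f[of w] by blast
      have "0 \<le> (\<Sum>i\<in>UNIV. w i * (x $ i - z $ i))"
      proof (rule sum_mult_nonneg_of_level_sums)
        show "(\<Sum>i\<in>UNIV. x $ i - z $ i) = 0"
          using z total_eq[OF x(1)] by (simp add: base_polyhedron_def coord_sum_def sum_subtractf)
        show "0 \<le> (\<Sum>i\<in>{i. t \<le> w i}. x $ i - z $ i)" for t
          using z x(2)[of t] by (auto simp: base_polyhedron_def coord_sum_def sum_subtractf)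
      qed
      also have "\<dots> = inner v z - inner v x"
        by (simp add: w_def inner_vec_def algebra_simps sum_subtractf sum_negf)
      finally show False using v x(1) by force
    qed
  qed
qed

subsection \<open>Least elements of base polyhedra\<close>

text \<open>The infimum of the slopes to the right is a subgradient; adding the subgradient
  inequalities at two points gives monotonicity.\<close>

lemma convex_subgradient:
  fixes \<phi> :: "real \<Rightarrow> real"
  assumes "convex_on UNIV \<phi>"
  obtains s where "\<And>u v. \<phi> u + s u * (v - u) \<le> \<phi> v" "mono s"
proof -
  define s where "s u = Inf ((\<lambda>t. (\<phi> u - \<phi> t) / (u - t)) ` ({u<..} \<inter> UNIV))" for u
  have s: "\<phi> u + s u * (v - u) \<le> \<phi> v" for u v
    unfolding s_def using convex_le_Inf_differential[OF assms, of u v] by simp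
  have "mono s"
  proof (rule monoI)
    fix u v :: real assume "u \<le> v"
    show "s u \<le> s v"
    proof (cases "u = v")
      case False
      then have "u < v" using \<open>u \<le> v\<close> by simp
      have "s u * (v - u) \<le> s v * (v - u)" using s[of u v] s[of v u] by (simp add: algebra_simps)
      then show ?thesis using \<open>u < v\<close> by simp
    qed simp
  qed
  with s show ?thesis by (rule that)
qed

section \<open>Tight sets of a submodular function\<close>

text \<open>\<open>coord_sum x\<close> is modular, so the slacks of union and intersection add up to
  at most the zero slacks of \<open>A\<close> and \<open>B\<close>; both are nonnegative, hence
  zero.\<close>

lemma submodular_tight_union_inter:
  fixes x :: "real ^ 'n::finite"
  assumes "submodular f" "x \<in> base_polyhedron f" "coord_sum x A = f A" "coord_sum x B = f B"
  shows "coord_sum x (A \<union> B) = f (A \<union> B)" "coord_sum x (A \<inter> B) = f (A \<inter> B)"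
proof -
  have "coord_sum x (A \<union> B) + coord_sum x (A \<inter> B) = coord_sum x A + coord_sum x B"
    unfolding coord_sum_def by (rule sum.union_inter) auto
  moreover have "f (A \<union> B) + f (A \<inter> B) \<le> f A + f B" using assms(1) by (simp add: submodular_def)
  moreover have "coord_sum x (A \<union> B) \<le> f (A \<union> B)" "coord_sum x (A \<inter> B) \<le> f (A \<inter> B)"
    using assms(2) by (auto simp: base_polyhedron_def)
  ultimately show "coord_sum x (A \<union> B) = f (A \<union> B)" "coord_sum x (A \<inter> B) = f (A \<inter> B)"
    using assms(3,4) by linarith+
qed

text \<open>\<open>L\<close> is the union over \<open>i \<in> L\<close> of the intersections over \<open>j \<notin> L\<close> of the separating tight sets.\<close>

lemma submodular_tight_of_separated:
  fixes x :: "real ^ 'n::finite"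
  assumes f: "submodular f" and x: "x \<in> base_polyhedron f"
    and sep: "\<And>i j. i \<in> L \<Longrightarrow> j \<notin> L \<Longrightarrow> \<exists>A. i \<in> A \<and> j \<notin> A \<and> coord_sum x A = f A"
  shows "coord_sum x L = f L"
proof -
  obtain T where T: "\<And>i j. i \<in> L \<Longrightarrow> j \<notin> L \<Longrightarrow> i \<in> T i j \<and> j \<notin> T i j \<and> coord_sum x (T i j) = f (T i j)"
    using sep by metis
  have inter: "coord_sum x (\<Inter>j\<in>J. T i j) = f (\<Inter>j\<in>J. T i j)" if "finite J" "i \<in> L" "J \<subseteq> - L" for i J
    using that
  proof (induction J)
    case empty
    \<comment> \<open>The empty intersection is the ground set, tight by the equality constraint of
      the base polyhedron.\<close>
    then show ?case using x by (simp add: base_polyhedron_def)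
  next
    case (insert j J)
    then show ?case using T[of i j] submodular_tight_union_inter(2)[OF f x, of "T i j"] by auto
  qed
  have union: "coord_sum x (\<Union>i\<in>I. \<Inter>j\<in>-L. T i j) = f (\<Union>i\<in>I. \<Inter>j\<in>-L. T i j)" if "finite I" "I \<subseteq> L" for I
    using that
  proof (induction I)
    case empty
    then show ?case using f by (simp add: submodular_def coord_sum_def)
  next
    case (insert i I)
    then show ?case
      using inter[of "- L" i] submodular_tight_union_inter(1)[OF f x, of "\<Inter>j\<in>-L. T i j"] by auto
  qed
  have "(\<Union>i\<in>L. \<Inter>j\<in>-L. T i j) = L" using T by blast
  then show ?thesis using union[of L] by simp
qed

section \<open>Exchange between two coordinates and the quadratic minimizer\<close>

lemma coord_sum_transfer:
  fixes x :: "real ^ 'n::finite"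
  shows "coord_sum (x + axis i \<epsilon> - axis j \<epsilon>) A =
    coord_sum x A + (if i \<in> A then \<epsilon> else 0) - (if j \<in> A then \<epsilon> else 0)"
  by (simp add: coord_sum_def axis_def sum.distrib sum_subtractf)

text \<open>Moving mass from \<open>j\<close> to \<open>i\<close> raises the sum only over sets
  containing \<open>i\<close> but not \<open>j\<close>; these are finitely many, so their slack has
  a positive minimum.\<close>

lemma transfer_in_base_polyhedron:
  fixes x :: "real ^ 'n::finite"
  assumes x: "x \<in> base_polyhedron f"
    and slack: "\<And>A. i \<in> A \<Longrightarrow> j \<notin> A \<Longrightarrow> coord_sum x A \<noteq> f A"
  obtains \<delta> where "\<delta> > 0"
    "\<And>\<epsilon>. 0 \<le> \<epsilon> \<Longrightarrow> \<epsilon> \<le> \<delta> \<Longrightarrow> x + axis i \<epsilon> - axis j \<epsilon> \<in> base_polyhedron f"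
proof -
  have le: "coord_sum x A \<le> f A" for A using x by (simp add: base_polyhedron_def)
  have less: "coord_sum x A < f A" if "i \<in> A" "j \<notin> A" for A
    using slack[OF that] le[of A] by simp
  \<comment> \<open>The extra 1 keeps the minimum defined when \<open>i = j\<close> and no such set
    exists.\<close>
  define S where "S = insert 1 ((\<lambda>A. f A - coord_sum x A) ` {A. i \<in> A \<and> j \<notin> A})"
  have S: "finite S" "S \<noteq> {}" by (auto simp: S_def)
  show ?thesis
  proof (rule that[of "Min S"])
    have "\<forall>s\<in>S. s > 0" using less by (auto simp: S_def)
    then show "Min S > 0" using S by simp
    fix \<epsilon> assume \<epsilon>: "0 \<le> \<epsilon>" "\<epsilon> \<le> Min S"
    have "coord_sum x A + \<epsilon> \<le> f A" if "i \<in> A" "j \<notin> A" for A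
    proof -
      have "Min S \<le> f A - coord_sum x A" using S that by (intro Min_le) (auto simp: S_def)
      then show ?thesis using \<epsilon> by simp
    qed
    then show "x + axis i \<epsilon> - axis j \<epsilon> \<in> base_polyhedron f"
      using x \<epsilon> le by (auto simp: base_polyhedron_def coord_sum_transfer intro: add_increasing2 order_trans[OF _ le])
  qed
qed

text \<open>Dividing by \<open>a\<close> makes the first-order change twice the difference of the
  ratios at \<open>i\<close> and \<open>j\<close>, the very quantities that
  \<open>ab_majorized\<close> feeds to the convex function.\<close>

lemma quadratic_transfer:
  fixes x a b :: "real ^ 'n::finite"
  assumes "\<And>i. a $ i > 0" "i \<noteq> j"
  shows "(\<Sum>k\<in>UNIV. ((x + axis i \<epsilon> - axis j \<epsilon>) $ k + b $ k)\<^sup>2 / a $ k) =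
    (\<Sum>k\<in>UNIV. (x $ k + b $ k)\<^sup>2 / a $ k)
      + \<epsilon> * (2 * ((x $ i + b $ i) / a $ i - (x $ j + b $ j) / a $ j) + \<epsilon> * (1 / a $ i + 1 / a $ j))"
proof -
  define p where "p = (x $ i + b $ i) / a $ i"
  define q where "q = (x $ j + b $ j) / a $ j"
  have "((x + axis i \<epsilon> - axis j \<epsilon>) $ k + b $ k)\<^sup>2 / a $ k = (x $ k + b $ k)\<^sup>2 / a $ k
      + (if k = i then \<epsilon> * (2 * p + \<epsilon> * (1 / a $ i)) else 0)
      + (if k = j then \<epsilon> * (- 2 * q + \<epsilon> * (1 / a $ j)) else 0)" for k
    using assms(1)[of k] assms(2)
    by (auto simp: p_def q_def axis_def field_simps power2_eq_square)
  then have "(\<Sum>k\<in>UNIV. ((x + axis i \<epsilon> - axis j \<epsilon>) $ k + b $ k)\<^sup>2 / a $ k) =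
      (\<Sum>k\<in>UNIV. (x $ k + b $ k)\<^sup>2 / a $ k) + \<epsilon> * (2 * p + \<epsilon> * (1 / a $ i)) + \<epsilon> * (- 2 * q + \<epsilon> * (1 / a $ j))"
    by (simp only: sum.distrib sum.delta finite UNIV_I if_True)
  then show ?thesis by (simp only: p_def q_def distrib_left right_diff_distrib)
qed

text \<open>If no tight set separates \<open>i\<close> in \<open>L\<close> from \<open>j\<close>
  outside, mass can move from \<open>j\<close> to \<open>i\<close>; the ratio at \<open>i\<close>
  being smaller, a small move lowers the quadratic.\<close>

lemma quadratic_minimizer_tight:
  fixes x a b :: "real ^ 'n::finite"
  assumes f: "submodular f" and a: "\<And>i. a $ i > 0" and x: "x \<in> base_polyhedron f"
    and min: "\<And>y. y \<in> base_polyhedron f \<Longrightarrow>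
      (\<Sum>k\<in>UNIV. (x $ k + b $ k)\<^sup>2 / a $ k) \<le> (\<Sum>k\<in>UNIV. (y $ k + b $ k)\<^sup>2 / a $ k)"
    and lower: "\<And>i j. i \<in> L \<Longrightarrow> j \<notin> L \<Longrightarrow> (x $ i + b $ i) / a $ i < (x $ j + b $ j) / a $ j"
  shows "coord_sum x L = f L"
proof (rule submodular_tight_of_separated[OF f x], rule ccontr)
  fix i j assume ij: "i \<in> L" "j \<notin> L"
    and "\<nexists>A. i \<in> A \<and> j \<notin> A \<and> coord_sum x A = f A"
  then have "\<And>A. i \<in> A \<Longrightarrow> j \<notin> A \<Longrightarrow> coord_sum x A \<noteq> f A" by blast
  then obtain \<delta> where \<delta>: "\<delta> > 0"
      "\<And>\<epsilon>. 0 \<le> \<epsilon> \<Longrightarrow> \<epsilon> \<le> \<delta> \<Longrightarrow> x + axis i \<epsilon> - axis j \<epsilon> \<in> base_polyhedron f"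
    using transfer_in_base_polyhedron[OF x, of i j] by metis
  define g where "g = (x $ j + b $ j) / a $ j - (x $ i + b $ i) / a $ i"
  define h where "h = 1 / a $ i + 1 / a $ j"
  have g: "g > 0" using lower[OF ij] by (simp add: g_def)
  have h: "h > 0" using a[of i] a[of j] by (simp add: h_def add_pos_pos)
  \<comment> \<open>\<open>\<delta>\<close> keeps the move feasible; \<open>g / h\<close> keeps the
    second-order cost below the first-order gain of \<open>2 * g\<close> per unit.\<close>
  define \<epsilon> where "\<epsilon> = min \<delta> (g / h)"
  have \<epsilon>: "0 < \<epsilon>" "\<epsilon> \<le> \<delta>" using \<delta>(1) g h by (auto simp: \<epsilon>_def)
  have "\<epsilon> \<le> g / h" by (simp add: \<epsilon>_def)
  then have "\<epsilon> * h \<le> g" using h by (simp add: pos_le_divide_eq)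
  then have "- 2 * g + \<epsilon> * h < 0" using g by linarith
  then have "\<epsilon> * (- 2 * g + \<epsilon> * h) < 0" using \<epsilon>(1) by (simp add: mult_pos_neg)
  moreover have "i \<noteq> j" using ij by blast
  ultimately show False
    using min[OF \<delta>(2)[of \<epsilon>]] \<epsilon> quadratic_transfer[OF a \<open>i \<noteq> j\<close>, of x \<epsilon> b]
    by (simp add: g_def h_def)
qed

text \<open>In the subgradient inequality at the ratios of \<open>x\<close>, the weights
  \<open>a\<close> cancel the denominators and leave \<open>s (u i) * (y $ i - x $ i)\<close>, whose
  sum is nonnegative by summation by parts.\<close>

lemma ab_majorized_of_tight_lower_levels:
  fixes x y a b :: "real ^ 'n::finite"
  assumes a: "\<And>i. a $ i > 0"
    and total: "coord_sum x UNIV = coord_sum y UNIV"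
    and lower: "\<And>L. (\<And>i j. i \<in> L \<Longrightarrow> j \<notin> L \<Longrightarrow> (x $ i + b $ i) / a $ i < (x $ j + b $ j) / a $ j) \<Longrightarrow>
      coord_sum y L \<le> coord_sum x L"
  shows "ab_majorized a b x y"
  unfolding ab_majorized_def
proof (intro conjI allI impI total)
  fix \<phi> :: "real \<Rightarrow> real" assume "continuous_on UNIV \<phi> \<and> convex_on UNIV \<phi>"
  then obtain s where s: "\<And>u v. \<phi> u + s u * (v - u) \<le> \<phi> v" "mono s"
    using convex_subgradient[of \<phi>] by metis
  define u where "u i = (x $ i + b $ i) / a $ i" for i
  define v where "v i = (y $ i + b $ i) / a $ i" for i
  have "0 \<le> (\<Sum>i\<in>UNIV. s (u i) * (y $ i - x $ i))"
  proof (rule sum_mult_nonneg_of_level_sums)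
    show "(\<Sum>i\<in>UNIV. y $ i - x $ i) = 0" using total by (simp add: coord_sum_def sum_subtractf)
    fix t
    let ?U = "{i. t \<le> s (u i)}"
    \<comment> \<open>As \<open>s\<close> is monotone, the complement of an upper level set of
      \<open>s\<close> along \<open>u\<close> is a lower set for \<open>u\<close>.\<close>
    have "coord_sum y (- ?U) \<le> coord_sum x (- ?U)"
    proof (rule lower)
      fix i j assume "i \<in> - ?U" "j \<notin> - ?U"
      then have "s (u i) < s (u j)" by simp
      then have "u i < u j" using monoD[OF s(2), of "u j" "u i"] by (rule_tac ccontr) simp
      then show "(x $ i + b $ i) / a $ i < (x $ j + b $ j) / a $ j" by (simp add: u_def)
    qed
    moreover have "coord_sum z UNIV = coord_sum z ?U + coord_sum z (- ?U)" for z :: "real ^ 'n"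
      unfolding coord_sum_def by (metis Compl_eq_Diff_UNIV add.commute finite sum.subset_diff top_greatest)
    ultimately show "0 \<le> (\<Sum>i\<in>?U. y $ i - x $ i)"
      using total by (simp add: coord_sum_def sum_subtractf)
  qed
  also have "\<dots> = (\<Sum>i\<in>UNIV. a $ i * (s (u i) * (v i - u i)))"
  proof (rule sum.cong)
    fix i
    have "a $ i * (v i - u i) = y $ i - x $ i" using a[of i] by (simp add: u_def v_def field_simps)
    then show "s (u i) * (y $ i - x $ i) = a $ i * (s (u i) * (v i - u i))" by (metis mult.left_commute)
  qed simp
  also have "\<dots> \<le> (\<Sum>i\<in>UNIV. a $ i * (\<phi> (v i) - \<phi> (u i)))"
  proof (intro sum_mono mult_left_mono)
    show "s (u i) * (v i - u i) \<le> \<phi> (v i) - \<phi> (u i)" for i using s(1)[of "u i" "v i"] by simp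
  qed (use a in \<open>simp add: less_imp_le\<close>)
  finally show "(\<Sum>i\<in>UNIV. a $ i * \<phi> ((x $ i + b $ i) / a $ i)) \<le> (\<Sum>i\<in>UNIV. a $ i * \<phi> ((y $ i + b $ i) / a $ i))"
    by (simp add: u_def v_def right_diff_distrib sum_subtractf)
qed

text \<open>The minimizer of one quadratic attains \<open>f\<close> on every lower set of its
  ratios, where no point of the polyhedron can exceed \<open>f\<close>.\<close>

lemma base_polyhedron_least_ab_majorized:
  fixes a b :: "real ^ 'n::finite"
  assumes f: "submodular f" and "compact (base_polyhedron f)" "base_polyhedron f \<noteq> {}"
    and a: "\<And>i. a $ i > 0"
  shows "\<exists>x. least_ab_majorized a b (base_polyhedron f) x"
proof -
  let ?q = "\<lambda>x. \<Sum>k\<in>UNIV. (x $ k + b $ k)\<^sup>2 / a $ k"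
  have "continuous_on (base_polyhedron f) ?q"
    using a by (intro continuous_intros) (metis less_irrefl)
  then obtain x where x: "x \<in> base_polyhedron f" "\<And>y. y \<in> base_polyhedron f \<Longrightarrow> ?q x \<le> ?q y"
    using continuous_attains_inf[OF assms(2,3), of ?q] by blast
  have "ab_majorized a b x y" if y: "y \<in> base_polyhedron f" for y
  proof (rule ab_majorized_of_tight_lower_levels[OF a])
    show "coord_sum x UNIV = coord_sum y UNIV" using x(1) y by (simp add: base_polyhedron_def)
    fix L assume "\<And>i j. i \<in> L \<Longrightarrow> j \<notin> L \<Longrightarrow> (x $ i + b $ i) / a $ i < (x $ j + b $ j) / a $ j"
    then have "coord_sum x L = f L" using quadratic_minimizer_tight[OF f a x] by blast
    then show "coord_sum y L \<le> coord_sum x L" using y by (simp add: base_polyhedron_def)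
  qed
  with x(1) show ?thesis by (auto simp: least_ab_majorized_def)
qed

section \<open>The cycle of implications\<close>

lemma submodular_max_coord_sum_nonempty:
  fixes C :: "(real ^ 'n::finite) set"
  assumes "submodular (max_coord_sum C)" "C = base_polyhedron (max_coord_sum C)"
  shows "C \<noteq> {}"
proof
  assume C: "C = {}"
  then have "max_coord_sum C A = max_coord_sum C {}" for A by (simp add: max_coord_sum_def)
  then have "max_coord_sum C A = 0" for A using assms(1) by (metis submodular_def)
  then have "0 \<in> base_polyhedron (max_coord_sum C)" by (simp add: base_polyhedron_def coord_sum_def)
  with assms(2) C show False by simp
qed

theorem theorem5:
  fixes C :: "(real ^ 'n::finite) set"
  assumes "compact C" and "convex C"
  shows
    "((\<forall>a b :: real ^ 'n. (\<forall>i. a $ i > 0) \<longrightarrow> (\<exists>x. least_ab_majorized a b C x))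
        \<longleftrightarrow> (\<forall>b :: real ^ 'n. \<exists>x. least_ab_majorized (\<chi> i. 1) b C x)) \<and>
     ((\<forall>b :: real ^ 'n. \<exists>x. least_ab_majorized (\<chi> i. 1) b C x)
        \<longleftrightarrow> (\<forall>b :: real ^ 'n. \<exists>x\<in>C. \<forall>\<Phi> :: real ^ 'n \<Rightarrow> real.
               continuous_on UNIV \<Phi> \<and> schur_convex \<Phi> \<longrightarrow>
               (\<forall>y\<in>C. \<Phi> (x + b) \<le> \<Phi> (y + b)))) \<and>
     ((\<forall>b :: real ^ 'n. \<exists>x\<in>C. \<forall>\<Phi> :: real ^ 'n \<Rightarrow> real.
          continuous_on UNIV \<Phi> \<and> schur_convex \<Phi> \<longrightarrow>
          (\<forall>y\<in>C. \<Phi> (x + b) \<le> \<Phi> (y + b)))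
        \<longleftrightarrow> submodular (max_coord_sum C) \<and> C = base_polyhedron (max_coord_sum C))"
    (is "(?P1 \<longleftrightarrow> ?P2) \<and> (?P2 \<longleftrightarrow> ?P3) \<and> (?P3 \<longleftrightarrow> ?P4)")
proof -
  have "?P1 \<Longrightarrow> ?P2" by simp
  moreover have "?P2 \<Longrightarrow> ?P3"
  proof
    fix b :: "real ^ 'n" assume ?P2
    then obtain x where "least_ab_majorized (\<chi> i. 1) b C x" by blast
    then show "\<exists>x\<in>C. \<forall>\<Phi> :: real ^ 'n \<Rightarrow> real. continuous_on UNIV \<Phi> \<and> schur_convex \<Phi> \<longrightarrow>
        (\<forall>y\<in>C. \<Phi> (x + b) \<le> \<Phi> (y + b))"
      unfolding least_ab_majorized_def schur_convex_def by (blast intro: majorized_of_ab_majorized)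
  qed
  moreover have "?P3 \<Longrightarrow> ?P4"
  proof -
    assume ?P3
    then have "\<exists>x\<in>C. \<forall>\<Phi>. continuous_on UNIV \<Phi> \<and> schur_convex \<Phi> \<longrightarrow> (\<forall>y\<in>C. \<Phi> (x + 0) \<le> \<Phi> (y + 0))"
      by (rule spec)
    then obtain x0 where x0: "x0 \<in> C"
      "\<And>\<Phi> y. continuous_on UNIV \<Phi> \<Longrightarrow> schur_convex \<Phi> \<Longrightarrow> y \<in> C \<Longrightarrow> \<Phi> x0 \<le> \<Phi> y"
      by auto
    \<comment> \<open>Majorization fixes the total, so the total and its negative are both
      Schur-convex; minimizing both at \<open>x0\<close> makes the total constant on
      \<open>C\<close>.\<close>
    have "coord_sum y UNIV = coord_sum x0 UNIV" if "y \<in> C" for y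
    proof (rule antisym)
      have "continuous_on UNIV (\<lambda>z :: real ^ 'n. coord_sum z UNIV)"
        unfolding coord_sum_def by (intro continuous_intros)
      moreover have "schur_convex (\<lambda>z :: real ^ 'n. coord_sum z UNIV)"
        "schur_convex (\<lambda>z :: real ^ 'n. - coord_sum z UNIV)"
        by (simp_all add: schur_convex_def majorized_def)
      ultimately show "coord_sum x0 UNIV \<le> coord_sum y UNIV" "coord_sum y UNIV \<le> coord_sum x0 UNIV"
        using x0(2)[of "\<lambda>z. coord_sum z UNIV" y] x0(2)[of "\<lambda>z. - coord_sum z UNIV" y] that
        by (simp_all add: continuous_on_minus)
    qed
    then have total: "coord_sum x UNIV = coord_sum y UNIV" if "x \<in> C" "y \<in> C" for x y
      using that by metis
    have "\<exists>x\<in>C. \<forall>t. \<forall>y\<in>C. (\<Sum>i\<in>UNIV. max 0 (t - (x + b) $ i)) \<le> (\<Sum>i\<in>UNIV. max 0 (t - (y + b) $ i))" for b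
    proof -
      obtain x where x: "x \<in> C" "\<And>\<Phi> y. continuous_on UNIV \<Phi> \<Longrightarrow> schur_convex \<Phi> \<Longrightarrow> y \<in> C \<Longrightarrow> \<Phi> (x + b) \<le> \<Phi> (y + b)"
        using \<open>?P3\<close> by metis
      have "continuous_on UNIV (\<lambda>z :: real ^ 'n. \<Sum>i\<in>UNIV. max 0 (t - z $ i))" for t
        by (intro continuous_intros)
      with x show ?thesis using schur_convex_sum_deficit by blast
    qed
    then have "\<exists>x\<in>C. \<forall>c. \<forall>y\<in>C. coord_sum y {i. c \<le> w i} \<le> coord_sum x {i. c \<le> w i}"
      for w :: "'n \<Rightarrow> real"
      using coord_sum_upper_level_maximizer[OF compact_imp_bounded[OF assms(1)], of w] by metis
    with submodular_base_polyhedron_of_upper_level_maximizers[OF assms _ total] x0(1)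
    show ?P4 by blast
  qed
  moreover have "?P4 \<Longrightarrow> ?P1"
  proof (intro allI impI)
    fix a b :: "real ^ 'n" assume P4: ?P4 and a: "\<forall>i. a $ i > 0"
    then have "C \<noteq> {}" using submodular_max_coord_sum_nonempty by blast
    with P4 assms(1) a base_polyhedron_least_ab_majorized[of "max_coord_sum C" a b]
    show "\<exists>x. least_ab_majorized a b C x" by simp
  qed
  ultimately show ?thesis by blast
qed

end
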